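(* Let $\mathcal{X}$ be a Banach space, let $\mathcal{Y} = L_\infty(\mathbb{R}^m)\cap C(\mathbb{R}^m)$ with the norm $\|\cdot\|_\infty$, and let $R_\alpha : \mathcal{Y}\to\mathcal{X}$ be a bounded linear operator (a linear regularization operator) with operator norm $\|R_\alpha\|_{\mathrm{op}(R_\alpha)}$. Let $b_1,\dots,b_n\in L_\infty(\mathbb{R}^m)\cap C(\mathbb{R}^m)$ be linearly independent, let $\mathcal{B}=\mathrm{span}\{b_1,\dots,b_n\}$, and let $\tilde\Xi=\{\xi_1,\dots,\xi_n\}\subset\mathbb{R}^m$ be such that the matrix $\mathsf{\Phi}=(b_j(\xi_i))_{i,j=1}^n$ is non-singular. Let $\Pi:\mathcal{Y}\to\mathcal{B}$ be the interpolation operator at $\tilde\Xi$ and let $\lambda$ be the associated Lebesgue function. Let $y\in L_\infty(\mathbb{R}^m)\cap C(\mathbb{R}^m)$ and let $y^\star\in\mathcal{B}$ be its best approximation in $\mathcal{B}$ with respect to the norm $\|\cdot\|_\infty$. Then $$\|R_\alpha y - R_\alpha \Pi y\|_{\mathcal{X}} \le \|R_\alpha\|_{\mathrm{op}(R_\alpha)}\,\|y-y^\star\|_\infty\left(1+\sup_{\xi\in\mathbb{R}^m}\lambda(\xi)\right).$$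
   Context: Given linearly independent functions $b_1,\dots,b_n\in L_\infty(\mathbb{R}^m)\cap C(\mathbb{R}^m)$ and nodes $\xi_1,\dots,\xi_n\in\mathbb{R}^m$ such that $\mathsf{\Phi}=(b_j(\xi_i))_{i,j=1}^n$ is non-singular, the cardinal (Lagrange) basis $\psi_1,\dots,\psi_n$ is the basis of $\mathcal{B}=\mathrm{span}\{b_1,\dots,b_n\}$ determined by $\psi_\ell(\xi_i)=\delta_{\ell i}$ for $i,\ell=1,\dots,n$. The interpolation (projection) operator is $\Pi y(\xi)=\sum_{i=1}^n y(\xi_i)\psi_i(\xi)$, i.e. $\Pi y$ is the unique element of $\mathcal{B}$ agreeing with $y$ at $\xi_1,\dots,\xi_n$. The Lebesgue function is $\lambda(\xi)=\sum_{i=1}^n|\psi_i(\xi)|$, $\xi\in\mathbb{R}^m$. A best approximation of $y$ in $\mathcal{B}$ with respect to $\|\cdot\|_\infty$ is an element $y^\star\in\mathcal{B}$ with $\|y-y^\star\|_\infty=\min_{g\in\mathcal{B}}\|y-g\|_\infty$. The operator norm $\|R_\alpha\|_{\mathrm{op}(R_\alpha)}$ is the one induced by the norms $\|\cdot\|_\infty$ on $\mathcal{Y}$ and $\|\cdot\|_{\mathcal{X}}$ on $\mathcal{X}$. *)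

theory Defs
  imports "HOL-Analysis.Analysis" "HOL-Probability.Essential_Supremum"
begin

(* The space of essentially bounded continuous functions on R^m, with the L_infinity norm, is
   rendered as the library type of bounded continuous functions with the supremum norm.
   The next two lemmas show that both the space and the norm are the intended ones. *)

lemma esssup_abs_continuous:
  fixes f :: "real^'m \<Rightarrow> real"
  assumes "continuous_on UNIV f"
  shows "esssup lborel (\<lambda>x. ereal \<bar>f x\<bar>) = (SUP x. ereal \<bar>f x\<bar>)"
proof (rule antisym)
  let ?s = "esssup lborel (\<lambda>x. ereal \<bar>f x\<bar>)"
  have cont: "continuous_on UNIV (\<lambda>x. ereal \<bar>f x\<bar>)"
    by (intro continuous_intros assms)
  then have meas: "(\<lambda>x. ereal \<bar>f x\<bar>) \<in> borel_measurable lborel"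
    using borel_measurable_continuous_onI by auto
  show "?s \<le> (SUP x. ereal \<bar>f x\<bar>)"
    by (rule esssup_I[OF meas], rule AE_I2, rule SUP_upper) simp
  have cl: "closed {x. ereal \<bar>f x\<bar> \<le> ?s}"
    by (intro closed_Collect_le cont continuous_on_const)
  have "AE x in lebesgue. x \<in> {x. ereal \<bar>f x\<bar> \<le> ?s}"
    using AE_completion[OF esssup_AE[of "\<lambda>x. ereal \<bar>f x\<bar>" lborel]] by simp
  then have "x \<in> {x. ereal \<bar>f x\<bar> \<le> ?s}" for x
    by (rule mem_closed_if_AE_lebesgue[OF cl])
  then show "(SUP x. ereal \<bar>f x\<bar>) \<le> ?s"
    by (auto intro: SUP_least)
qed

lemma bcontfun_iff_esssup_finite:
  fixes f :: "real^'m \<Rightarrow> real"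
  assumes "continuous_on UNIV f"
  shows "f \<in> bcontfun \<longleftrightarrow> esssup lborel (\<lambda>x. ereal \<bar>f x\<bar>) < \<infinity>"
proof
  assume "f \<in> bcontfun"
  then obtain c where "\<And>x. \<bar>f x\<bar> \<le> c"
    by (auto simp: bcontfun_def bounded_iff)
  then have "(SUP x. ereal \<bar>f x\<bar>) \<le> ereal c"
    by (auto intro: SUP_least)
  then show "esssup lborel (\<lambda>x. ereal \<bar>f x\<bar>) < \<infinity>"
    using esssup_abs_continuous[OF assms] by (auto intro: le_less_trans)
next
  assume "esssup lborel (\<lambda>x. ereal \<bar>f x\<bar>) < \<infinity>"
  then have "(SUP x. ereal \<bar>f x\<bar>) < \<infinity>"
    using esssup_abs_continuous[OF assms] by simp
  then obtain c where c: "(SUP x. ereal \<bar>f x\<bar>) < ereal c"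
    using less_PInf_Ex_of_nat by auto
  have "\<bar>f x\<bar> \<le> c" for x
    using SUP_upper[of x UNIV "\<lambda>x. ereal \<bar>f x\<bar>"] c by (auto dest: order.strict_trans1)
  then show "f \<in> bcontfun"
    by (intro bcontfun_normI[of _ c] assms) auto
qed

lemma norm_bcontfun_eq_esssup:
  fixes g :: "(real^'m) \<Rightarrow>\<^sub>C real"
  shows "ereal (norm g) = esssup lborel (\<lambda>x. ereal \<bar>apply_bcontfun g x\<bar>)"
proof -
  have bd: "\<bar>apply_bcontfun g x\<bar> \<le> norm g" for x
    using norm_bounded[of g x] by simp
  have "ereal (norm g) = (SUP x. ereal \<bar>apply_bcontfun g x\<bar>)"
  proof (rule antisym)
    show "(SUP x. ereal \<bar>apply_bcontfun g x\<bar>) \<le> ereal (norm g)"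
      using bd by (auto intro: SUP_least)
    show "ereal (norm g) \<le> (SUP x. ereal \<bar>apply_bcontfun g x\<bar>)"
    proof (cases "SUP x. ereal \<bar>apply_bcontfun g x\<bar>")
      case (real r)
      then have "\<bar>apply_bcontfun g x\<bar> \<le> r" for x
        using SUP_upper[of x UNIV "\<lambda>x. ereal \<bar>apply_bcontfun g x\<bar>"] by simp
      then show ?thesis
        using real norm_bound[of g r] by simp
    next
      case MInf
      then show ?thesis
        using SUP_upper[of undefined UNIV "\<lambda>x. ereal \<bar>apply_bcontfun g x\<bar>"] by simp
    qed simp
  qed
  then show ?thesis
    using esssup_abs_continuous[of "apply_bcontfun g"] by simp
qed

definition is_cardinal_basis ::
  "('n::finite \<Rightarrow> (real^'m) \<Rightarrow>\<^sub>C real) \<Rightarrow> ('n \<Rightarrow> real^'m) \<Rightarrow> ('n \<Rightarrow> (real^'m) \<Rightarrow>\<^sub>C real) \<Rightarrow> bool"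
  where "is_cardinal_basis b \<xi> \<psi> \<longleftrightarrow>
    inj \<psi> \<and> independent (range \<psi>) \<and> span (range \<psi>) = span (range b) \<and>
    (\<forall>l i. apply_bcontfun (\<psi> l) (\<xi> i) = (if l = i then 1 else 0))"

(* The description is proper when the matrix (b_j(xi_i)) is non-singular. *)
definition cardinal_basis ::
  "('n::finite \<Rightarrow> (real^'m) \<Rightarrow>\<^sub>C real) \<Rightarrow> ('n \<Rightarrow> real^'m) \<Rightarrow> 'n \<Rightarrow> (real^'m) \<Rightarrow>\<^sub>C real"
  where "cardinal_basis b \<xi> = (THE \<psi>. is_cardinal_basis b \<xi> \<psi>)"

definition interpolation ::
  "('n::finite \<Rightarrow> (real^'m) \<Rightarrow>\<^sub>C real) \<Rightarrow> ('n \<Rightarrow> real^'m) \<Rightarrow> (real^'m) \<Rightarrow>\<^sub>C real \<Rightarrow> (real^'m) \<Rightarrow>\<^sub>C real"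
  where "interpolation b \<xi> y = (\<Sum>i\<in>UNIV. apply_bcontfun y (\<xi> i) *\<^sub>R cardinal_basis b \<xi> i)"

definition lebesgue_function ::
  "('n::finite \<Rightarrow> (real^'m) \<Rightarrow>\<^sub>C real) \<Rightarrow> ('n \<Rightarrow> real^'m) \<Rightarrow> real^'m \<Rightarrow> real"
  where "lebesgue_function b \<xi> x = (\<Sum>i\<in>UNIV. \<bar>apply_bcontfun (cardinal_basis b \<xi> i) x\<bar>)"

(* Hence the real-valued supremum of the Lebesgue function is a genuine one. *)
lemma bdd_above_lebesgue_function: "bdd_above (range (lebesgue_function b \<xi>))"
proof (rule bdd_aboveI2)
  fix x
  show "lebesgue_function b \<xi> x \<le> (\<Sum>i\<in>UNIV. norm (cardinal_basis b \<xi> i))"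
    unfolding lebesgue_function_def
    using norm_bounded[of "cardinal_basis b \<xi> _" x] by (auto intro!: sum_mono)
qed

definition is_best_approximation :: "'a::real_normed_vector set \<Rightarrow> 'a \<Rightarrow> 'a \<Rightarrow> bool"
  where "is_best_approximation B y g \<longleftrightarrow> g \<in> B \<and> (\<forall>h\<in>B. norm (y - g) \<le> norm (y - h))"

end

theory Submission
  imports Defs
begin

text \<open>
  The estimate is the Lebesgue inequality for interpolation, followed by one application of the
  operator norm. Since interpolation reproduces every element of the span \<open>\<B>\<close> of the \<open>b j\<close>, in
  particular \<open>ystar\<close>, the error satisfies
  \<open>y - \<Pi> y = (y - ystar) - \<Pi> (y - ystar)\<close>. The pointwise triangle inequality shows that the
  supremum of the Lebesgue function bounds the norm of \<open>\<Pi>\<close>, so the right-hand side is at most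
  \<open>1 + sup \<lambda>\<close> times the norm of \<open>y - ystar\<close>.

  The cardinal basis is given by a definite description, so everything rests on its unique
  existence (\<open>ex1_cardinal_basis\<close>). Uniqueness comes from unisolvence: because the collocation
  matrix is non-singular, an element of \<open>\<B>\<close> is determined by its values at the nodes
  (\<open>span_eqI_nodes\<close>). Existence comes from using the columns of the inverse matrix as
  coefficients; unisolvence then gives the reproduction formula, and thus equality of the spans.
\<close>

lemma linear_apply_bcontfun:
  "linear (\<lambda>f :: 'a::topological_space \<Rightarrow>\<^sub>C 'b::real_normed_vector. apply_bcontfun f x)"
  by (rule linearI) simp_all

lemma apply_bcontfun_sum:
  fixes f :: "'i \<Rightarrow> 'a::topological_space \<Rightarrow>\<^sub>C 'b::real_normed_vector"
  shows "apply_bcontfun (sum f S) x = (\<Sum>i\<in>S. apply_bcontfun (f i) x)"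
  by (rule linear_sum[OF linear_apply_bcontfun])

abbreviation collocation_matrix ::
  "('n::finite \<Rightarrow> (real^'m) \<Rightarrow>\<^sub>C real) \<Rightarrow> ('n \<Rightarrow> real^'m) \<Rightarrow> real^'n^'n"
  where "collocation_matrix b \<xi> \<equiv> \<chi> i j. apply_bcontfun (b j) (\<xi> i)"

text \<open>
  In terms of coefficient vectors, interpolation from the span is a square linear system; this
  is how the non-singularity of the matrix is brought to bear on functions.
\<close>

lemma apply_combination_nodes:
  "apply_bcontfun (\<Sum>j\<in>UNIV. (c $ j) *\<^sub>R b j) (\<xi> i) = (collocation_matrix b \<xi> *v c) $ i"
  by (simp add: apply_bcontfun_sum matrix_vector_mult_def mult.commute)

lemma span_range_combination:
  fixes b :: "'n::finite \<Rightarrow> 'v::real_vector"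
  assumes "g \<in> span (range b)"
  obtains c :: "real^'n" where "g = (\<Sum>j\<in>UNIV. (c $ j) *\<^sub>R b j)"
proof -
  have "\<exists>c :: real^'n. g = (\<Sum>j\<in>UNIV. (c $ j) *\<^sub>R b j)"
    using assms
  proof (induction rule: span_induct_alt)
    case base
    show ?case
      by (rule exI[of _ 0]) simp
  next
    case (step a v h)
    then obtain k and c :: "real^'n"
      where "v = b k" and "h = (\<Sum>j\<in>UNIV. (c $ j) *\<^sub>R b j)"
      by auto
    then have "a *\<^sub>R v + h = (\<Sum>j\<in>UNIV. ((axis k a + c) $ j) *\<^sub>R b j)"
      by (simp add: axis_def scaleR_left_distrib sum.distrib if_distrib[of "\<lambda>r. r *\<^sub>R _"]
          cong: if_cong)
    then show ?case
      by blast
  qed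
  then show ?thesis
    using that by blast
qed

text \<open>Unisolvence: vanishing node values force the coefficient vector into the trivial kernel.\<close>

lemma span_eqI_nodes:
  fixes b :: "'n::finite \<Rightarrow> (real^'m) \<Rightarrow>\<^sub>C real"
  assumes inv: "invertible (collocation_matrix b \<xi>)"
    and "f \<in> span (range b)" and "g \<in> span (range b)"
    and nodes: "\<And>i. apply_bcontfun f (\<xi> i) = apply_bcontfun g (\<xi> i)"
  shows "f = g"
proof -
  have "f - g \<in> span (range b)"
    using assms(2,3) by (rule span_diff)
  then obtain c where c: "f - g = (\<Sum>j\<in>UNIV. (c $ j) *\<^sub>R b j)"
    by (rule span_range_combination)
  have "(collocation_matrix b \<xi> *v c) $ i = 0" for i
    unfolding apply_combination_nodes[symmetric] c[symmetric] using nodes by simp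
  then have "collocation_matrix b \<xi> *v c = 0"
    by (simp add: vec_eq_iff)
  moreover obtain A where "A ** collocation_matrix b \<xi> = mat 1"
    using inv unfolding invertible_def by blast
  ultimately have "c = 0"
    by (metis matrix_left_invertible_ker)
  then show ?thesis
    using c by simp
qed

text \<open>
  For cardinal functions in the span, the remaining requirements on a cardinal basis follow:
  evaluation at the node \<open>\<xi> l\<close> separates \<open>\<psi> l\<close> from the span of the other cardinal functions, and
  unisolvence identifies each element of the span with its expansion in the cardinal functions.
\<close>

lemma is_cardinal_basisI:
  fixes b :: "'n::finite \<Rightarrow> (real^'m) \<Rightarrow>\<^sub>C real"
  assumes inv: "invertible (collocation_matrix b \<xi>)"
    and mem: "\<And>l. \<psi> l \<in> span (range b)"
    and delta: "\<And>l i. apply_bcontfun (\<psi> l) (\<xi> i) = (if l = i then 1 else 0)"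
  shows "is_cardinal_basis b \<xi> \<psi>"
  unfolding is_cardinal_basis_def
proof (intro conjI allI)
  show "inj \<psi>"
    by (rule injI) (metis delta zero_neq_one)
  show "independent (range \<psi>)"
    unfolding dependent_def
  proof safe
    fix l
    assume "\<psi> l \<in> span (range \<psi> - {\<psi> l})"
    then have "apply_bcontfun (\<psi> l) (\<xi> l) = 0"
      by (rule linear_eq_0_on_span[OF linear_apply_bcontfun, rotated]) (auto simp: delta)
    then show False
      by (simp add: delta)
  qed
  show "span (range \<psi>) = span (range b)"
  proof
    show "span (range \<psi>) \<subseteq> span (range b)"
      using mem by (intro span_minimal subspace_span) auto
    show "span (range b) \<subseteq> span (range \<psi>)"
    proof
      fix g
      assume g: "g \<in> span (range b)"
      have "g = (\<Sum>i\<in>UNIV. apply_bcontfun g (\<xi> i) *\<^sub>R \<psi> i)"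
      proof (rule span_eqI_nodes[OF inv g])
        show "(\<Sum>i\<in>UNIV. apply_bcontfun g (\<xi> i) *\<^sub>R \<psi> i) \<in> span (range b)"
          by (intro span_sum span_scale mem)
      qed (simp add: apply_bcontfun_sum delta if_distrib cong: if_cong)
      also have "\<dots> \<in> span (range \<psi>)"
        by (intro span_sum span_scale span_base) simp
      finally show "g \<in> span (range \<psi>)" .
    qed
  qed
qed (rule delta)

lemma ex1_cardinal_basis:
  fixes b :: "'n::finite \<Rightarrow> (real^'m) \<Rightarrow>\<^sub>C real"
  assumes inv: "invertible (collocation_matrix b \<xi>)"
  shows "\<exists>!\<psi>. is_cardinal_basis b \<xi> \<psi>"
proof (rule ex_ex1I)
  obtain B where B: "collocation_matrix b \<xi> ** B = mat 1"
    using inv unfolding invertible_def by blast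
  \<comment> \<open>The \<open>l\<close>-th column of the inverse solves the system whose right-hand side is the \<open>l\<close>-th unit
    vector, that is, the cardinality conditions for \<open>\<psi> l\<close>.\<close>
  define \<psi> where "\<psi> l = (\<Sum>j\<in>UNIV. (column l B $ j) *\<^sub>R b j)" for l
  have "apply_bcontfun (\<psi> l) (\<xi> i) = (if l = i then 1 else 0)" for l i
  proof -
    have "apply_bcontfun (\<psi> l) (\<xi> i) = (collocation_matrix b \<xi> ** B) $ i $ l"
      unfolding \<psi>_def apply_combination_nodes
      by (simp add: matrix_vector_mult_def matrix_matrix_mult_def column_def)
    then show ?thesis
      by (simp add: B mat_def)
  qed
  moreover have "\<psi> l \<in> span (range b)" for l
    unfolding \<psi>_def by (intro span_sum span_scale span_base) simp
  ultimately show "\<exists>\<psi>. is_cardinal_basis b \<xi> \<psi>"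
    using is_cardinal_basisI[OF inv] by blast
next
  fix \<psi> \<psi>'
  assume *: "is_cardinal_basis b \<xi> \<psi>" "is_cardinal_basis b \<xi> \<psi>'"
  then have "\<psi> l \<in> span (range b)" "\<psi>' l \<in> span (range b)" for l
    unfolding is_cardinal_basis_def by (metis rangeI span_base)+
  then show "\<psi> = \<psi>'"
    using * by (intro ext span_eqI_nodes[OF inv]) (simp_all add: is_cardinal_basis_def)
qed

lemma is_cardinal_basis_cardinal_basis:
  assumes "invertible (collocation_matrix b \<xi>)"
  shows "is_cardinal_basis b \<xi> (cardinal_basis b \<xi>)"
  unfolding cardinal_basis_def by (rule theI'[OF ex1_cardinal_basis[OF assms]])

lemma interpolation_reproduces_span:
  assumes inv: "invertible (collocation_matrix b \<xi>)" and g: "g \<in> span (range b)"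
  shows "interpolation b \<xi> g = g"
proof (rule span_eqI_nodes[OF inv _ g])
  note cb = is_cardinal_basis_cardinal_basis[OF inv, unfolded is_cardinal_basis_def]
  have delta: "apply_bcontfun (cardinal_basis b \<xi> l) (\<xi> i) = (if l = i then 1 else 0)" for l i
    using cb by blast
  have "cardinal_basis b \<xi> i \<in> span (range b)" for i
    using cb by (metis rangeI span_base)
  then show "interpolation b \<xi> g \<in> span (range b)"
    unfolding interpolation_def by (intro span_sum span_scale)
  show "apply_bcontfun (interpolation b \<xi> g) (\<xi> i) = apply_bcontfun g (\<xi> i)" for i
    by (simp add: interpolation_def apply_bcontfun_sum delta if_distrib cong: if_cong)
qed

lemma interpolation_diff:
  "interpolation b \<xi> (f - g) = interpolation b \<xi> f - interpolation b \<xi> g"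
  by (simp add: interpolation_def scaleR_left_diff_distrib sum_subtractf)

text \<open>
  At each point the interpolant is a combination of node values, each at most the norm of \<open>f\<close>,
  with weights whose absolute values add up to the Lebesgue function.
\<close>

lemma norm_interpolation_le:
  "norm (interpolation b \<xi> f) \<le> norm f * (SUP x. lebesgue_function b \<xi> x)"
proof (rule norm_bound)
  fix x
  have "norm (apply_bcontfun (interpolation b \<xi> f) x)
      \<le> (\<Sum>i\<in>UNIV. \<bar>apply_bcontfun f (\<xi> i)\<bar> * \<bar>apply_bcontfun (cardinal_basis b \<xi> i) x\<bar>)"
    unfolding interpolation_def apply_bcontfun_sum
    by (rule order_trans[OF norm_sum]) (simp add: abs_mult)
  also have "\<dots> \<le> (\<Sum>i\<in>UNIV. norm f * \<bar>apply_bcontfun (cardinal_basis b \<xi> i) x\<bar>)"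
    using norm_bounded[of f] by (intro sum_mono mult_right_mono) auto
  also have "\<dots> = norm f * lebesgue_function b \<xi> x"
    by (simp add: lebesgue_function_def sum_distrib_left)
  also have "\<dots> \<le> norm f * (SUP x. lebesgue_function b \<xi> x)"
    by (intro mult_left_mono cSUP_upper bdd_above_lebesgue_function) auto
  finally show "norm (apply_bcontfun (interpolation b \<xi> f) x)
      \<le> norm f * (SUP x. lebesgue_function b \<xi> x)" .
qed

text \<open>
  Subtracting \<open>g\<close> from \<open>y\<close> leaves the interpolation error unchanged because \<open>g\<close> is reproduced; this
  is how the distance to an arbitrary element of the span enters.
\<close>

lemma lebesgue_inequality:
  assumes inv: "invertible (collocation_matrix b \<xi>)" and g: "g \<in> span (range b)"
  shows "norm (y - interpolation b \<xi> y)
    \<le> norm (y - g) * (1 + (SUP x. lebesgue_function b \<xi> x))"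
proof -
  have "y - interpolation b \<xi> y = (y - g) - interpolation b \<xi> (y - g)"
    by (simp add: interpolation_diff interpolation_reproduces_span[OF inv g])
  then have "norm (y - interpolation b \<xi> y) \<le> norm (y - g) + norm (interpolation b \<xi> (y - g))"
    by (metis norm_triangle_ineq4)
  also have "\<dots> \<le> norm (y - g) * (1 + (SUP x. lebesgue_function b \<xi> x))"
    using norm_interpolation_le[of b \<xi> "y - g"] by (simp add: distrib_left)
  finally show ?thesis .
qed

theorem theorem3p2:
  fixes R :: "((real^'m) \<Rightarrow>\<^sub>C real) \<Rightarrow> 'x::banach"
    and b :: "'n::finite \<Rightarrow> (real^'m) \<Rightarrow>\<^sub>C real"
    and \<xi> :: "'n \<Rightarrow> real^'m"
    and y ystar :: "(real^'m) \<Rightarrow>\<^sub>C real"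
  assumes "bounded_linear R"
    and "inj b" and "independent (range b)"
    and "invertible ((\<chi> i j. apply_bcontfun (b j) (\<xi> i)) :: real^'n^'n)"
    and "is_best_approximation (span (range b)) y ystar"
  shows "norm (R y - R (interpolation b \<xi> y))
    \<le> onorm R * norm (y - ystar) * (1 + (SUP x. lebesgue_function b \<xi> x))"
proof -
  have ystar: "ystar \<in> span (range b)"
    using assms(5) by (simp add: is_best_approximation_def)
  have "norm (R y - R (interpolation b \<xi> y)) = norm (R (y - interpolation b \<xi> y))"
    by (simp add: linear_diff[OF bounded_linear.linear[OF assms(1)]])
  also have "\<dots> \<le> onorm R * norm (y - interpolation b \<xi> y)"
    by (rule onorm[OF assms(1)])
  also have "\<dots> \<le> onorm R * (norm (y - ystar) * (1 + (SUP x. lebesgue_function b \<xi> x)))"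
    by (intro mult_left_mono lebesgue_inequality[OF assms(4) ystar] onorm_pos_le[OF assms(1)])
  finally show ?thesis
    by (simp add: mult.assoc)
qed

end
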